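(* Let $s \geq 1$ and $N \geq 1$ be integers and let $q \in (0,1)$. Let $z_1, \ldots, z_N$ be independent random variables, each uniformly distributed on $[0,1]^s$. Then, with probability at least $q$, $$D^*_N(z_1, \ldots, z_N) \leq 5.7 \sqrt{4.9 + \log \left((1-q)^{-1}\right)} \, \frac{\sqrt{s}}{\sqrt{N}}.$$
   Context: For $x = (x_1,\ldots,x_s)$ and $y = (y_1,\ldots,y_s)$ in $[0,1]^s$, write $y \leq x$ if $y_i \leq x_i$ for all $1 \leq i \leq s$, and let $[0,x] = \{y \in [0,1]^s : 0 \leq y \leq x\}$. Let $\lambda$ denote the $s$-dimensional Lebesgue measure. The star-discrepancy of points $z_1, \ldots, z_N \in [0,1]^s$ is $$D_N^*(z_1,\ldots,z_N) = \sup_{x \in [0,1]^s} \left| \frac{1}{N} \sum_{n=1}^N \mathbf{1}_{[0,x]}(z_n) - \lambda([0,x]) \right|.$$ Here $\log$ denotes the natural logarithm. *)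

theory Defs
  imports "HOL-Probability.Probability"
begin

text \<open>The order on \<open>real ^ 's\<close> is componentwise, so \<open>{0..x}\<close> is the anchored box
  and \<open>{0..1}\<close> the unit cube; the dimension is \<open>CARD('s)\<close>. For \<open>N \<ge> 1\<close> the
  supremum of reals is over a nonempty set bounded by 1.\<close>

definition star_discrepancy :: "nat \<Rightarrow> (nat \<Rightarrow> real ^ 's) \<Rightarrow> real" where
  "star_discrepancy N z =
     (SUP x \<in> {0..1}. \<bar>(1 / real N) * (\<Sum>n = 1..N. indicator {0..x} (z n)) - measure lborel {0..x}\<bar>)"

end

theory Submission
  imports Defs
begin

text \<open>
  The proof is dyadic chaining over bracketing covers of the family of anchored boxes. Write
  \<open>s\<close> for the dimension, \<open>t = ln (1 / (1 - q))\<close>, and \<open>D(A)\<close> for the number of sample points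
  in \<open>A\<close> minus \<open>N \<lambda>(A)\<close>; this is additive in \<open>A\<close>. With \<open>T = sqrt ((4.9 + t) s N)\<close> it
  suffices to show that \<open>\<bar>D [0,x]\<bar> \<le> 5.7 T\<close> for all \<open>x\<close>, outside an event of probability at
  most \<open>exp (- t) = 1 - q\<close>.

  \<^emph>\<open>Covers.\<close> For each \<open>k\<close>, consider the boxes \<open>[0,w]\<close> whose corner has coordinates
  \<open>w\<^sub>i = exp (- f\<^sub>i / (s 2 ^ k))\<close> for naturals \<open>f\<^sub>i\<close> with bounded sum. Increasing all
  indices by one divides the volume by \<open>exp (1 / 2 ^ k)\<close>, and every anchored box is enclosed
  between two grid boxes (or the empty set and a grid box) whose volumes differ by at most
  \<open>1 / 2 ^ k\<close> (\<open>grid_boxes_bracket\<close>). The bound on the sum, of order \<open>s k 2 ^ k\<close>, keeps the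
  number of grid boxes at most \<open>exp (s (k + 2))\<close> for \<open>k \<ge> 4\<close> (\<open>card_grid_boxes\<close>): the exponent
  is linear in \<open>s\<close>, without the factor \<open>log s\<close> that an equidistant grid would cost.

  \<^emph>\<open>Chaining.\<close> A box at level \<open>k + 1\<close> contains a parent, either empty or a box of level \<open>k\<close>,
  such that the difference has volume at most \<open>1 / 2 ^ k\<close>. Hence \<open>D\<close> of a fine box is \<open>D\<close> of
  a level \<open>4\<close> box, or of the empty set, plus the values of \<open>D\<close> on such differences
  (\<open>local_discrepancy_chain\<close>). Hoeffding's inequality controls all boxes of level \<open>4\<close>, with
  deviation \<open>T\<close>. A Bernstein-type inequality (\<open>bernstein_dev\<close>) exploits the small volume of
  the differences and allows the geometrically decreasing deviations \<open>9/10 (3/4) ^ j T\<close>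
  between the levels \<open>4 + j\<close> and \<open>5 + j\<close>. The failure probabilities sum up to at most
  \<open>exp (- t)\<close>.

  The chain stops at the first level \<open>4 + J\<close> with \<open>N / 2 ^ (4 + J) \<le> T\<close>; there the
  bracketing of \<open>[0,x]\<close> costs at most another \<open>T\<close>. In total
  \<open>\<bar>D [0,x]\<bar> \<le> T + 3.6 T + T \<le> 5.7 T\<close>.
\<close>

section \<open>Anchored boxes and a multiplicative grid of bracketing boxes\<close>

lemma measure_anchored_box:
  fixes a :: "real ^ 's"
  assumes "0 \<le> a"
  shows "measure lborel {0..a} = (\<Prod>i\<in>UNIV. a $ i)"
proof -
  have "cbox 0 a \<noteq> {}" using assms by (auto simp: interval_cbox_cart[symmetric])
  then show ?thesis using content_cbox_cart[of 0 a] by (simp add: interval_cbox_cart)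
qed

lemma fmeasurable_anchored_box: "{0..a :: real ^ 's} \<in> fmeasurable lborel"
  by (metis fmeasurable_cbox interval_cbox_cart)

text \<open>The point whose \<open>i\<close>-th coordinate is the \<open>f i\<close>-th term of the geometric sequence with ratio
  \<open>exp (- h)\<close>, starting from \<open>1\<close>.\<close>

definition grid_point :: "real \<Rightarrow> ('s::finite \<Rightarrow> nat) \<Rightarrow> real ^ 's" where
  "grid_point h f = (\<chi> i. exp (- (h * real (f i))))"

text \<open>The bracketing boxes of level \<open>k\<close>. With step \<open>1 / (s 2 ^ k)\<close>, increasing every index by one
  divides the volume by \<open>exp (1 / 2 ^ k)\<close>. A box whose index sum is at least \<open>s k 2 ^ k\<close> has volume at
  most \<open>exp (- k) \<le> 1 / 2 ^ k\<close>, so that no larger indices are needed; the extra \<open>s\<close> in the bound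
  makes room for increasing all indices by one.\<close>

definition grid_boxes :: "nat \<Rightarrow> (real ^ 's) set set" where
  "grid_boxes k = (\<lambda>f. {0..grid_point (1 / (real CARD('s) * 2 ^ k)) f}) `
     {f :: 's \<Rightarrow> nat. sum f UNIV \<le> CARD('s) * (k * 2 ^ k + 1)}"

lemma grid_point_nonneg: "0 \<le> grid_point h f"
  by (simp add: grid_point_def less_eq_vec_def)

lemma grid_point_le_1: "h \<ge> 0 \<Longrightarrow> grid_point h f \<le> 1"
  by (simp add: grid_point_def less_eq_vec_def)

lemma measure_grid_box:
  fixes f :: "'s::finite \<Rightarrow> nat"
  shows "measure lborel {0..grid_point h f} = exp (- (h * real (sum f UNIV)))"
  by (simp add: measure_anchored_box grid_point_nonneg)
     (simp add: grid_point_def exp_sum[symmetric] sum_negf sum_distrib_left)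

lemma grid_boxes_unit_cube: "A \<in> grid_boxes k \<Longrightarrow> A \<subseteq> {0..1}"
  unfolding grid_boxes_def by (auto intro!: order_trans[OF _ grid_point_le_1])

lemma grid_boxes_fmeasurable: "A \<in> grid_boxes k \<Longrightarrow> A \<in> fmeasurable lborel"
  unfolding grid_boxes_def by (auto simp: fmeasurable_anchored_box)

text \<open>The bound comes from the generating function: every \<open>f\<close> that is counted satisfies
  \<open>r ^ (s m) \<le> r ^ (\<Sum>i. f i)\<close> for \<open>0 < r < 1\<close>, and the sum of the right-hand side over all
  \<open>f\<close> factorises into geometric series. The choice \<open>r = m / (m + 1)\<close> is optimal for the infinite series.\<close>

lemma count_bounded_sum:
  fixes m :: nat
  assumes "m \<ge> 1"
  defines "F \<equiv> {f :: 's::finite \<Rightarrow> nat. sum f UNIV \<le> CARD('s) * m}"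
  shows "finite F" and "real (card F) \<le> (exp 1 * real (m + 1)) ^ CARD('s)"
proof -
  define s where "s = CARD('s)"
  define r where "r = real m / real (m + 1)"
  have r: "0 < r" "r < 1" using assms by (auto simp: r_def)
  have le: "f i \<le> s * m" if "f \<in> F" for f i
    using that member_le_sum[of i UNIV f] by (auto simp: F_def s_def intro: order_trans)
  then have sub: "F \<subseteq> PiE UNIV (\<lambda>_. {..s * m})" by (auto simp: PiE_def)
  have fin: "finite (PiE (UNIV :: 's set) (\<lambda>_. {..s * m}))"
    by (intro finite_PiE) auto
  show "finite F" by (rule finite_subset[OF sub fin])
  have "r ^ (s * m) * real (card F) = (\<Sum>f\<in>F. r ^ (s * m))" by simp
  also have "\<dots> \<le> (\<Sum>f\<in>F. r ^ sum f UNIV)"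
    using r by (intro sum_mono power_decreasing) (auto simp: F_def s_def)
  also have "\<dots> \<le> (\<Sum>f\<in>PiE (UNIV :: 's set) (\<lambda>_. {..s * m}). r ^ sum f UNIV)"
    using r by (intro sum_mono2 fin sub) auto
  also have "\<dots> = (\<Sum>f\<in>PiE (UNIV :: 's set) (\<lambda>_. {..s * m}). \<Prod>i\<in>UNIV. r ^ f i)"
    by (simp add: power_sum)
  also have "\<dots> = (\<Prod>i\<in>(UNIV::'s set). \<Sum>j\<le>s * m. r ^ j)"
    by (subst prod_sum_PiE) auto
  also have "\<dots> = (\<Sum>j\<le>s * m. r ^ j) ^ s" by (simp add: s_def)
  also have "\<dots> \<le> real (m + 1) ^ s"
  proof (rule power_mono)
    have "(\<Sum>j\<le>s * m. r ^ j) = (1 - r ^ Suc (s * m)) / (1 - r)"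
      using r by (subst sum_gp0) (auto simp: divide_simps)
    also have "\<dots> \<le> 1 / (1 - r)" using r by (intro divide_right_mono) auto
    also have "\<dots> = real (m + 1)" by (simp add: r_def field_simps)
    finally show "(\<Sum>j\<le>s * m. r ^ j) \<le> real (m + 1)" .
  qed (use r in \<open>auto intro: sum_nonneg\<close>)
  finally have 1: "r ^ (s * m) * real (card F) \<le> real (m + 1) ^ s" .
  have "(1 / r) ^ m = (1 + 1 / real m) ^ m" using assms by (simp add: r_def field_simps)
  also have "\<dots> \<le> exp (1 / real m) ^ m"
    by (intro power_mono exp_ge_add_one_self) auto
  also have "\<dots> = exp 1" using assms by (simp add: exp_of_nat_mult[symmetric])
  finally have "1 \<le> exp 1 * r ^ m" using r by (simp add: field_simps)
  then have 2: "1 \<le> exp 1 ^ s * r ^ (s * m)"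
    by (metis one_le_power power_mult power_mult_distrib mult.commute)
  have "real (card F) \<le> (exp 1 ^ s * r ^ (s * m)) * real (card F)"
    using 2 by (metis mult_right_mono mult_1 of_nat_0_le_iff)
  also have "\<dots> \<le> exp 1 ^ s * real (m + 1) ^ s"
    using 1 by (simp add: mult.assoc)
  finally show "real (card F) \<le> (exp 1 * real (m + 1)) ^ CARD('s)"
    by (simp add: s_def power_mult_distrib)
qed

lemma finite_grid_boxes: "finite (grid_boxes k :: (real ^ 's) set set)"
  unfolding grid_boxes_def by (intro finite_imageI count_bounded_sum) auto

lemma card_grid_boxes:
  assumes "k \<ge> 4"
  shows "real (card (grid_boxes k :: (real ^ 's) set set)) \<le> exp (real CARD('s) * (real k + 2))"
proof -
  have e: "exp 1 \<ge> (5/2::real)" using exp_lower_Taylor_quadratic[of 1] by simp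
  have k: "real k * 2 ^ k + 2 \<le> exp (real k + 1)"
    using assms
  proof (induction k rule: dec_induct)
    case base
    have "66 \<le> (5/2::real) ^ 5" by (simp add: power_divide)
    also have "\<dots> \<le> exp 1 ^ 5" by (intro power_mono e) auto
    also have "\<dots> = exp (5 * 1)" by (subst exp_of_nat_mult[symmetric]) simp
    finally show ?case by simp
  next
    case (step n)
    have "real (Suc n) * 2 ^ Suc n + 2 \<le> 5/2 * (real n * 2 ^ n + 2)"
    proof -
      have "2 * (real n + 1) * 2 ^ n \<le> 5/2 * real n * (2::real) ^ n"
        using step.hyps by (intro mult_right_mono) auto
      moreover have "real (Suc n) * 2 ^ Suc n = 2 * (real n + 1) * 2 ^ n" by simp
      moreover have "5/2 * (real n * 2 ^ n + 2) = 5/2 * real n * 2 ^ n + 5" by (simp add: field_simps)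
      ultimately show ?thesis by linarith
    qed
    also have "\<dots> \<le> exp 1 * exp (real n + 1)"
      using step.IH e by (intro mult_mono) auto
    also have "\<dots> = exp (real (Suc n) + 1)" by (simp add: exp_add[symmetric] add_ac)
    finally show ?case .
  qed
  have "card (grid_boxes k :: (real ^ 's) set set) \<le>
      card {f :: 's \<Rightarrow> nat. sum f UNIV \<le> CARD('s) * (k * 2 ^ k + 1)}"
    unfolding grid_boxes_def by (intro card_image_le count_bounded_sum) auto
  then have "real (card (grid_boxes k :: (real ^ 's) set set)) \<le>
      real (card {f :: 's \<Rightarrow> nat. sum f UNIV \<le> CARD('s) * (k * 2 ^ k + 1)})" by simp
  also have "\<dots> \<le> (exp 1 * real (k * 2 ^ k + 1 + 1)) ^ CARD('s)"
    by (rule count_bounded_sum) auto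
  also have "\<dots> \<le> (exp 1 * exp (real k + 1)) ^ CARD('s)"
    using k by (intro power_mono mult_left_mono) auto
  also have "\<dots> = exp (real CARD('s) * (real k + 2))"
    by (simp add: exp_add[symmetric] exp_of_nat_mult[symmetric] add.commute)
  finally show ?thesis .
qed

text \<open>Used to replace a grid box of too large an index by an admissible one containing it.\<close>

lemma exists_smaller_with_sum:
  fixes f :: "'s::finite \<Rightarrow> nat"
  assumes "n \<le> sum f UNIV"
  obtains g where "g \<le> f" "sum g UNIV = n"
proof -
  have "\<exists>g\<le>f. sum g UNIV = n" using assms
  proof (induction n)
    case 0
    show ?case by (intro exI[of _ "\<lambda>_. 0"]) (auto simp: le_fun_def)
  next
    case (Suc n)
    then obtain g where g: "g \<le> f" "sum g UNIV = n" by auto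
    have "\<exists>i. g i < f i"
    proof (rule ccontr)
      assume "\<not> ?thesis"
      then have "sum f UNIV \<le> sum g UNIV" by (intro sum_mono) (auto simp: not_less)
      with g Suc.prems show False by simp
    qed
    then obtain i where i: "g i < f i" ..
    have "sum (g(i := g i + 1)) UNIV = (g i + 1) + sum g (UNIV - {i})"
      by (subst sum.remove[of _ i]) (auto intro!: sum.cong)
    also have "\<dots> = Suc n" using g(2) by (subst (asm) sum.remove[of _ i]) auto
    finally show ?case using g(1) i by (intro exI[of _ "g(i := g i + 1)"]) (auto simp: le_fun_def)
  qed
  then show ?thesis using that by blast
qed

lemma grid_boxes_bracket:
  fixes x :: "real ^ 's"
  assumes x: "x \<in> {0..1}"
  obtains v w where "v \<in> insert {} (grid_boxes k)" "w \<in> grid_boxes k"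
    "v \<subseteq> {0..x}" "{0..x} \<subseteq> w" "measure lborel w - measure lborel v \<le> 1 / 2 ^ k"
proof -
  define s where "s = CARD('s)"
  have s: "s > 0" by (simp add: s_def)
  define h where "h = 1 / (real s * 2 ^ k)"
  have h: "h > 0" using s by (simp add: h_def)
  define m where "m = k * 2 ^ k + 1"
  define box where "box f = {0..grid_point h (f :: 's \<Rightarrow> nat)}" for f
  have in_grid: "box f \<in> grid_boxes k" if "sum f UNIV \<le> s * m" for f
    using that by (auto simp: grid_boxes_def box_def h_def s_def m_def)
  have x01: "0 \<le> x $ i" "x $ i \<le> 1" for i using x by (auto simp: less_eq_vec_def)
  \<comment> \<open>The index of a vanishing coordinate should be infinite; one beyond the admissible total has the
    same effect.\<close>
  define f where "f i = (if x $ i = 0 then s * m + 1 else nat \<lfloor>- ln (x $ i) / h\<rfloor>)" for i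
  have upper: "x $ i \<le> exp (- (h * real (f i)))" for i
  proof (cases "x $ i = 0")
    case False
    then have "0 < x $ i" using x01[of i] by simp
    moreover have "0 \<le> - ln (x $ i) / h" using x01[of i] h \<open>0 < x $ i\<close> by (simp add: divide_nonpos_pos)
    then have "real (f i) \<le> - ln (x $ i) / h" using False by (simp add: f_def)
    then have "ln (x $ i) \<le> - (h * real (f i))" using h by (simp add: field_simps)
    ultimately show ?thesis by (metis exp_ln exp_le_cancel_iff)
  qed auto
  \<comment> \<open>If \<open>f + 1\<close> is an admissible index, the boxes of \<open>f + 1\<close> and \<open>f\<close> form the bracket. Otherwise the
    box is so small that the empty set serves as the lower bracket.\<close>
  show ?thesis
  proof (cases "sum f UNIV + s \<le> s * m")
    case True
    have nz: "x $ i \<noteq> 0" for i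
    proof
      assume "x $ i = 0"
      then have "s * m + 1 \<le> f i" by (simp add: f_def)
      also have "f i \<le> sum f UNIV" by (intro member_le_sum) auto
      finally show False using True by simp
    qed
    have lower: "exp (- (h * real (f i + 1))) \<le> x $ i" for i
    proof -
      have pos: "0 < x $ i" using x01[of i] nz[of i] by simp
      have "0 \<le> - ln (x $ i) / h" using x01[of i] h pos by (simp add: divide_nonpos_pos)
      then have "- ln (x $ i) / h \<le> real (f i + 1)" using nz[of i] unfolding f_def by auto linarith
      then have "- (h * real (f i + 1)) \<le> ln (x $ i)" using h by (simp add: field_simps)
      then show ?thesis using pos by (metis exp_ln exp_le_cancel_iff)
    qed
    have sum1: "sum (\<lambda>i. f i + 1) UNIV = sum f UNIV + s" 
      by (simp only: sum.distrib) (simp add: s_def)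
    have "measure lborel (box f) - measure lborel (box (\<lambda>i. f i + 1)) =
        exp (- (h * real (sum f UNIV))) * (1 - exp (- (h * s)))"
      unfolding box_def measure_grid_box sum1 
      by (simp add: algebra_simps exp_add[symmetric])
    also have "\<dots> \<le> 1 * (h * s)"
      using exp_ge_add_one_self[of "- (h * s)"] h
      by (intro mult_mono) (auto simp: sum_nonneg)
    also have "\<dots> = 1 / 2 ^ k" using s by (simp add: h_def)
    finally have "measure lborel (box f) - measure lborel (box (\<lambda>i. f i + 1)) \<le> 1 / 2 ^ k" .
    moreover have "box (\<lambda>i. f i + 1) \<subseteq> {0..x}" "{0..x} \<subseteq> box f"
      using lower upper by (auto simp: box_def grid_point_def less_eq_vec_def intro: order_trans)
    moreover have "box f \<in> grid_boxes k" using True by (intro in_grid) simp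
    moreover have "box (\<lambda>i. f i + 1) \<in> grid_boxes k" by (rule in_grid, unfold sum1, rule True)
    ultimately show ?thesis using that by blast
  next
    case False
    define n where "n = min (sum f UNIV) (s * m)"
    obtain g where g: "g \<le> f" "sum g UNIV = n"
      by (rule exists_smaller_with_sum[of n f]) (auto simp: n_def)
    have "s * (k * 2 ^ k) \<le> n" using False by (auto simp: n_def m_def)
    then have "real (s * (k * 2 ^ k)) \<le> real n" by linarith
    then have "real k \<le> h * real n" using s by (simp add: h_def field_simps)
    then have "measure lborel (box g) \<le> exp (- real k)"
      by (simp add: box_def measure_grid_box g)
    also have "\<dots> = 1 / exp 1 ^ k" by (simp add: exp_minus exp_of_nat_mult[symmetric] field_simps)
    also have "\<dots> \<le> 1 / 2 ^ k"
      using exp_ge_add_one_self[of 1] by (intro divide_left_mono power_mono) auto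
    finally have "measure lborel (box g) - measure lborel {} \<le> 1 / 2 ^ k" by simp
    moreover have "{0..x} \<subseteq> box g"
    proof -
      have "x $ i \<le> exp (- (h * real (g i)))" for i
      proof -
        have "g i \<le> f i" using g(1) by (simp add: le_fun_def)
        then have "exp (- (h * real (f i))) \<le> exp (- (h * real (g i)))" using h by simp
        with upper[of i] show ?thesis by linarith
      qed
      then show ?thesis by (auto simp: box_def grid_point_def less_eq_vec_def intro: order_trans)
    qed
    moreover have "box g \<in> grid_boxes k" by (intro in_grid) (simp add: g n_def)
    ultimately show ?thesis using that[of "{}" "box g"] by blast
  qed
qed

section \<open>Concentration of the number of sample points in a set\<close>

text \<open>The unnormalised discrepancy on a single set: the number of points in \<open>A\<close> minus its
  expectation under the uniform distribution.\<close>

definition local_discrepancy :: "nat \<Rightarrow> (nat \<Rightarrow> real ^ 's) \<Rightarrow> (real ^ 's) set \<Rightarrow> real" where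
  "local_discrepancy N z A = (\<Sum>n = 1..N. indicator A (z n)) - real N * measure lborel A"

text \<open>A sample of \<open>N \<ge> 1\<close> independent uniformly distributed points of the unit cube.\<close>

locale uniform_sample = prob_space M for M :: "'a measure" +
  fixes z :: "nat \<Rightarrow> 'a \<Rightarrow> real ^ 's" and N :: nat
  assumes N: "N \<ge> 1"
    and indep: "indep_vars (\<lambda>_. borel) z {1..N}"
    and uniform: "\<And>n. n \<in> {1..N} \<Longrightarrow> distr M borel (z n) = uniform_measure lborel {0..1}"
begin

abbreviation dev :: "(real ^ 's) set \<Rightarrow> 'a \<Rightarrow> real" where
  "dev A \<omega> \<equiv> local_discrepancy N (\<lambda>n. z n \<omega>) A"

lemma measurable_point [measurable]: "n \<in> {1..N} \<Longrightarrow> z n \<in> borel_measurable M"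
  using indep by (auto simp: indep_vars_def)

lemma measurable_dev [measurable]:
  assumes [measurable]: "A \<in> sets borel"
  shows "dev A \<in> borel_measurable M"
  unfolding local_discrepancy_def by measurable

lemma prob_point:
  assumes A: "A \<in> sets borel" "A \<subseteq> {0..1}" and n: "n \<in> {1..N}"
  shows "prob (z n -` A \<inter> space M) = measure lborel A"
proof -
  have e1: "emeasure lborel {0..1 :: real ^ 's} = 1"
    using measure_anchored_box[of "1 :: real ^ 's"]
    by (subst emeasure_eq_measure2[OF fmeasurable_anchored_box]) (simp add: less_eq_vec_def)
  have "prob (z n -` A \<inter> space M) = measure (distr M borel (z n)) A"
    using A n by (subst measure_distr) auto
  also have "\<dots> = measure (uniform_measure lborel {0..1}) A" by (simp add: uniform[OF n])
  also have "emeasure (uniform_measure lborel {0..1}) A = emeasure lborel A"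
    using A e1 by (subst emeasure_uniform_measure) (auto simp: Int_absorb1 divide_ennreal_def)
  then have "measure (uniform_measure lborel {0..1}) A = measure lborel A"
    by (simp add: measure_def)
  finally show ?thesis .
qed

lemma expectation_indicator_point:
  assumes A: "A \<in> sets borel" "A \<subseteq> {0..1}" and n: "n \<in> {1..N}"
  shows "expectation (\<lambda>\<omega>. indicator A (z n \<omega>) :: real) = measure lborel A"
proof -
  have "expectation (\<lambda>\<omega>. indicator A (z n \<omega>) :: real) =
      expectation (indicator (z n -` A \<inter> space M))"
    by (intro Bochner_Integration.integral_cong) (auto simp: indicator_def)
  also have "\<dots> = prob (z n -` A \<inter> space M)"
    using A n by simp
  finally show ?thesis by (simp add: prob_point[OF A n])
qed

lemma indep_indicator:
  assumes [measurable]: "A \<in> sets borel"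
  shows "indep_vars (\<lambda>_. borel) (\<lambda>n \<omega>. indicator A (z n \<omega>) :: real) {1..N}"
  by (rule indep_vars_compose2[OF indep]) measurable

lemma hoeffding_dev:
  assumes A: "A \<in> sets borel" "A \<subseteq> {0..1}" and "\<epsilon> \<ge> 0"
  shows "prob {\<omega> \<in> space M. \<bar>dev A \<omega>\<bar> \<ge> \<epsilon>} \<le> 2 * exp (- 2 * \<epsilon>\<^sup>2 / real N)"
proof -
  interpret H: Hoeffding_ineq M "{1..N}" "\<lambda>n \<omega>. indicator A (z n \<omega>) :: real"
    "\<lambda>_. 0" "\<lambda>_. 1" "real N * measure lborel A"
  proof unfold_locales
    have "(\<Sum>n = 1..N. expectation (\<lambda>\<omega>. indicator A (z n \<omega>) :: real)) = real N * measure lborel A"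
      using expectation_indicator_point[OF A] by simp
    then show "real N * measure lborel A \<equiv> (\<Sum>n = 1..N. expectation (\<lambda>\<omega>. indicator A (z n \<omega>) :: real))"
      by simp
  qed (use indep_indicator[OF A(1)] in \<open>auto split: split_indicator\<close>)
  show ?thesis
    using H.Hoeffding_ineq_abs_ge[OF \<open>\<epsilon> \<ge> 0\<close>] N by (simp add: local_discrepancy_def)
qed

text \<open>For a Bernoulli variable with parameter \<open>p\<close>, the centred moment generating function is at most
  \<open>exp (p (exp \<theta> - 1 - \<theta>))\<close>, and \<open>exp \<theta> - 1 - \<theta> \<le> \<theta>\<^sup>2\<close> for \<open>\<bar>\<theta>\<bar> \<le> 1\<close>.\<close>

lemma expectation_exp_dev:
  assumes A: "A \<in> sets borel" "A \<subseteq> {0..1}" and "\<bar>\<theta>\<bar> \<le> 1"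
  shows "integrable M (\<lambda>\<omega>. exp (\<theta> * dev A \<omega>))"
    and "expectation (\<lambda>\<omega>. exp (\<theta> * dev A \<omega>)) \<le> exp (real N * measure lborel A * \<theta>\<^sup>2)"
proof -
  note [measurable] = A(1)
  define p where "p = measure lborel A"
  have p: "p \<ge> 0" by (simp add: p_def)
  define X where "X n \<omega> = exp (\<theta> * (indicator A (z n \<omega>) - p))" for n \<omega>
  have split: "exp (\<theta> * dev A \<omega>) = (\<Prod>n = 1..N. X n \<omega>)" for \<omega>
    by (simp add: X_def local_discrepancy_def p_def exp_sum[symmetric] sum_distrib_left[symmetric]
        sum_subtractf)
  have indepX: "indep_vars (\<lambda>_. borel) X {1..N}"
    unfolding X_def by (rule indep_vars_compose2[OF indep]) measurable
  have lin: "exp (\<theta> * indicator A y) = 1 + (exp \<theta> - 1) * indicator A y" for y :: "real ^ 's"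
    by (simp add: indicator_def)
  have intI: "integrable M (\<lambda>\<omega>. indicator A (z n \<omega>) :: real)" if "n \<in> {1..N}" for n
    by (rule integrable_const_bound[where B = 1]) (use that in \<open>auto simp: indicator_def\<close>)
  have X_eq: "X n = (\<lambda>\<omega>. exp (- \<theta> * p) * (1 + (exp \<theta> - 1) * indicator A (z n \<omega>)))" for n
    unfolding X_def lin[symmetric] exp_add[symmetric] by (simp add: algebra_simps)
  have intX: "integrable M (X n)" if "n \<in> {1..N}" for n
    unfolding X_eq using intI[OF that] by simp
  show "integrable M (\<lambda>\<omega>. exp (\<theta> * dev A \<omega>))"
    unfolding split by (intro indep_vars_integrable indepX intX) auto
  have exp_le: "exp \<theta> \<le> 1 + \<theta> + \<theta>\<^sup>2"
  proof (cases "\<theta> \<ge> 0")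
    case True
    then show ?thesis using exp_bound[of \<theta>] assms(3) by auto
  next
    case False
    then have "1 + (-\<theta>) + (-\<theta>)\<^sup>2 / 2 \<le> exp (- \<theta>)"
      using exp_lower_Taylor_quadratic[of "-\<theta>"] by auto
    then have "exp \<theta> \<le> 1 / (1 - \<theta> + \<theta>\<^sup>2 / 2)"
      using le_imp_inverse_le[of "1 - \<theta> + \<theta>\<^sup>2 / 2" "exp (-\<theta>)"] False
      by (simp add: exp_minus inverse_eq_divide add_pos_nonneg)
    also have "\<dots> \<le> 1 + \<theta> + \<theta>\<^sup>2"
    proof -
      have "1 \<le> (1 + \<theta> + \<theta>\<^sup>2) * (1 - \<theta> + \<theta>\<^sup>2 / 2)"
      proof -
        have "(1 + \<theta> + \<theta>\<^sup>2) * (1 - \<theta> + \<theta>\<^sup>2 / 2) - 1 = \<theta>\<^sup>2 * (1 - \<theta> + \<theta>\<^sup>2) / 2"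
          by (simp add: power2_eq_square field_simps)
        also have "\<dots> \<ge> 0" using False by auto
        finally show ?thesis by simp
      qed
      then show ?thesis using False by (simp add: divide_le_eq add_pos_nonneg)
    qed
    finally show ?thesis .
  qed
  have EX: "expectation (X n) \<le> exp (p * \<theta>\<^sup>2)" if n: "n \<in> {1..N}" for n
  proof -
    have "expectation (X n) = exp (- \<theta> * p) * (1 + (exp \<theta> - 1) * p)"
      unfolding X_eq using intI[OF n] expectation_indicator_point[OF A n]
      by (simp add: p_def prob_space)
    also have "\<dots> \<le> exp (- \<theta> * p) * exp ((exp \<theta> - 1) * p)"
      by (intro mult_left_mono exp_ge_add_one_self) auto
    also have "\<dots> = exp (p * (exp \<theta> - 1 - \<theta>))" by (simp add: exp_add[symmetric] algebra_simps)
    also have "\<dots> \<le> exp (p * \<theta>\<^sup>2)" using exp_le p by (auto intro!: mult_left_mono)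
    finally show ?thesis .
  qed
  have "expectation (\<lambda>\<omega>. exp (\<theta> * dev A \<omega>)) = (\<Prod>n = 1..N. expectation (X n))"
    unfolding split by (intro indep_vars_lebesgue_integral indepX intX) auto
  also have "\<dots> \<le> (\<Prod>n = 1..N. exp (p * \<theta>\<^sup>2))"
    by (intro prod_mono) (auto simp: EX X_def)
  also have "\<dots> = exp (real N * p * \<theta>\<^sup>2)"
    by (simp add: exp_of_nat_mult[symmetric] mult_ac)
  finally show "expectation (\<lambda>\<omega>. exp (\<theta> * dev A \<omega>)) \<le> exp (real N * measure lborel A * \<theta>\<^sup>2)"
    by (simp add: p_def)
qed

text \<open>A Bernstein-type inequality in the range of deviations where the tail is Gaussian with variance
  proportional to the volume. The Chernoff parameter \<open>\<epsilon> / (2 N P)\<close> minimises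
  \<open>- \<theta> \<epsilon> + N P \<theta>\<^sup>2\<close>, and the upper bound on \<open>\<epsilon>\<close> says that it does not exceed \<open>1\<close>.\<close>

lemma bernstein_dev:
  assumes A: "A \<in> sets borel" "A \<subseteq> {0..1}" and P: "measure lborel A \<le> P" "P > 0"
    and \<epsilon>: "\<epsilon> > 0" "\<epsilon> \<le> 2 * real N * P"
  shows "prob {\<omega> \<in> space M. \<bar>dev A \<omega>\<bar> \<ge> \<epsilon>} \<le> 2 * exp (- (\<epsilon>\<^sup>2 / (4 * real N * P)))"
proof -
  note [measurable] = A(1)
  define \<theta> where "\<theta> = \<epsilon> / (2 * real N * P)"
  have \<theta>: "0 < \<theta>" "\<theta> \<le> 1" using \<epsilon> P N by (auto simp: \<theta>_def)
  have bound: "exp (- \<theta> * \<epsilon>) * expectation (\<lambda>\<omega>. exp (\<sigma> * dev A \<omega>)) \<le> exp (- (\<epsilon>\<^sup>2 / (4 * real N * P)))"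
    if "\<sigma>\<^sup>2 = \<theta>\<^sup>2" for \<sigma>
  proof -
    have "\<bar>\<sigma>\<bar> = \<bar>\<theta>\<bar>" using that by (metis real_sqrt_abs)
    then have "expectation (\<lambda>\<omega>. exp (\<sigma> * dev A \<omega>)) \<le> exp (real N * measure lborel A * \<sigma>\<^sup>2)"
      using \<theta> by (intro expectation_exp_dev A) auto
    also have "\<dots> \<le> exp (real N * P * \<theta>\<^sup>2)"
      using P that by (auto intro!: mult_right_mono mult_left_mono)
    finally have "exp (- \<theta> * \<epsilon>) * expectation (\<lambda>\<omega>. exp (\<sigma> * dev A \<omega>)) \<le>
        exp (- \<theta> * \<epsilon>) * exp (real N * P * \<theta>\<^sup>2)" by (intro mult_left_mono) auto
    also have "\<dots> = exp (- (\<epsilon>\<^sup>2 / (4 * real N * P)))"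
      using N P by (simp add: exp_add[symmetric] \<theta>_def field_simps power2_eq_square)
    finally show ?thesis .
  qed
  have set_int: "(\<integral>\<omega>\<in>space M. f \<omega> \<partial>M) = expectation f" for f :: "'a \<Rightarrow> real"
    unfolding set_lebesgue_integral_def by (intro Bochner_Integration.integral_cong) auto
  have int: "set_integrable M (space M) (\<lambda>\<omega>. exp (\<sigma> * dev A \<omega>))" if "\<bar>\<sigma>\<bar> \<le> 1" for \<sigma>
    using expectation_exp_dev(1)[OF A that] 
    unfolding set_integrable_def by (intro integrable_mult_indicator) auto
  have ge: "prob {\<omega> \<in> space M. dev A \<omega> \<ge> \<epsilon>} \<le> exp (- (\<epsilon>\<^sup>2 / (4 * real N * P)))"
    using Chernoff_ineq_ge[of \<theta> "space M" "dev A" \<epsilon>] int[of \<theta>] bound[of \<theta>] \<theta>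
    by (auto simp: set_int)
  have le: "prob {\<omega> \<in> space M. dev A \<omega> \<le> - \<epsilon>} \<le> exp (- (\<epsilon>\<^sup>2 / (4 * real N * P)))"
    using Chernoff_ineq_le[of \<theta> "space M" "dev A" "-\<epsilon>"] int[of "-\<theta>"] bound[of "-\<theta>"] \<theta>
    by (auto simp: set_int)
  have "{\<omega> \<in> space M. \<bar>dev A \<omega>\<bar> \<ge> \<epsilon>} =
      {\<omega> \<in> space M. dev A \<omega> \<ge> \<epsilon>} \<union> {\<omega> \<in> space M. dev A \<omega> \<le> - \<epsilon>}" by auto
  also have "prob \<dots> \<le> prob {\<omega> \<in> space M. dev A \<omega> \<ge> \<epsilon>} + prob {\<omega> \<in> space M. dev A \<omega> \<le> - \<epsilon>}"
    by (intro measure_Un_le) measurable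
  finally show ?thesis using ge le by simp
qed

end

section \<open>Measurability of the star discrepancy\<close>

lemma star_discrepancy_le_iff:
  fixes z :: "nat \<Rightarrow> real ^ 's"
  assumes N: "N \<ge> 1"
  shows "star_discrepancy N z \<le> c \<longleftrightarrow>
     (\<forall>x\<in>{0..1}. \<bar>local_discrepancy N z {0..x}\<bar> \<le> real N * c)"
proof -
  define F where "F x = \<bar>(1 / real N) * (\<Sum>n = 1..N. indicator {0..x} (z n)) - measure lborel {0..x}\<bar>"
    for x :: "real ^ 's"
  have F: "real N * F x = \<bar>local_discrepancy N z {0..x}\<bar>" for x
  proof -
    have "real N * F x = \<bar>real N * ((1 / real N) * (\<Sum>n = 1..N. indicator {0..x} (z n)) - measure lborel {0..x})\<bar>"
      by (simp add: F_def abs_mult)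
    also have "\<dots> = \<bar>local_discrepancy N z {0..x}\<bar>"
      using N by (simp add: local_discrepancy_def right_diff_distrib)
    finally show ?thesis .
  qed
  have "F x \<le> 2" if "x \<in> {0..1}" for x :: "real ^ 's"
  proof -
    have "(\<Sum>n = 1..N. indicator {0..x} (z n)) \<le> (\<Sum>n = 1..N. 1 :: real)"
      by (intro sum_mono) (auto simp: indicator_def)
    then have 1: "(\<Sum>n = 1..N. indicator {0..x} (z n)) \<le> real N" by simp
    have 2: "0 \<le> (\<Sum>n = 1..N. indicator {0..x} (z n) :: real)" by (intro sum_nonneg) auto
    have "measure lborel {0..x} \<le> 1"
      using that by (auto simp: measure_anchored_box less_eq_vec_def intro!: prod_le_1)
    then have 3: "real N * measure lborel {0..x} \<le> real N"
      by (simp add: mult_left_le)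
    have 4: "0 \<le> real N * measure lborel {0..x}" by simp
    have "real N * F x \<le> real N * 2" unfolding F local_discrepancy_def using 1 2 3 4 by linarith
    then show ?thesis using N by simp
  qed
  then have bdd: "bdd_above (F ` {0..1})" by (intro bdd_aboveI2) auto
  have "star_discrepancy N z \<le> c \<longleftrightarrow> (\<forall>x\<in>{0..1}. F x \<le> c)"
    unfolding star_discrepancy_def F_def[symmetric] using bdd
    by (intro cSUP_le_iff) (auto simp: less_eq_vec_def)
  also have "\<dots> \<longleftrightarrow> (\<forall>x\<in>{0..1}. real N * F x \<le> real N * c)" using N by simp
  finally show ?thesis by (simp add: F)
qed

text \<open>Closed boxes make the discrepancy continuous from the upper right, so the corner is approximated
  by rational points \<open>y m \<ge> x\<close> within the cube. This reduces the supremum to countably many boxes.\<close>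

lemma local_discrepancy_rational_approx:
  fixes z :: "nat \<Rightarrow> real ^ 's" and x :: "real ^ 's"
  assumes x: "x \<in> {0..1}"
  obtains y where "\<And>m. y m \<in> {0..1}" "\<And>m i. y m $ i \<in> \<rat>"
    "(\<lambda>m. local_discrepancy N z {0..y m}) \<longlonglongrightarrow> local_discrepancy N z {0..x}"
proof -
  have x01: "0 \<le> x $ i" "x $ i \<le> 1" for i using x by (auto simp: less_eq_vec_def)
  have "\<exists>r\<in>\<rat>. x $ i < r \<and> r < x $ i + 1 / real (Suc m)" for m i
    by (rule Rats_dense_in_real) auto
  then have "\<forall>m i. \<exists>r. r \<in> \<rat> \<and> x $ i < r \<and> r < x $ i + 1 / real (Suc m)" by blast
  then obtain r where "\<forall>m i. r m i \<in> \<rat> \<and> x $ i < r m i \<and> r m i < x $ i + 1 / real (Suc m)"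
    unfolding choice_iff by blast
  then have r: "\<And>m i. r m i \<in> \<rat>" "\<And>m i. x $ i < r m i"
      "\<And>m i. r m i < x $ i + 1 / real (Suc m)" by blast+
  define y where "y m = (\<chi> i. min 1 (r m i))" for m
  have xy: "x $ i \<le> y m $ i" for m i using r(2)[of i m] x01[of i] by (simp add: y_def)
  have y01: "y m \<in> {0..1}" for m
    using xy x01 by (auto simp: less_eq_vec_def intro: order_trans) (simp add: y_def)
  have lim: "(\<lambda>m. y m $ i) \<longlonglongrightarrow> x $ i" for i
  proof (rule tendsto_sandwich[OF _ _ tendsto_const])
    show "\<forall>\<^sub>F m in sequentially. x $ i \<le> y m $ i" by (simp add: xy)
    show "\<forall>\<^sub>F m in sequentially. y m $ i \<le> x $ i + 1 / real (Suc m)"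
      using r(3)[THEN less_imp_le] by (auto simp: y_def min.coboundedI2)
    show "(\<lambda>m. x $ i + 1 / real (Suc m)) \<longlonglongrightarrow> x $ i"
      using tendsto_add[OF tendsto_const LIMSEQ_inverse_real_of_nat, of "x $ i"]
      by (simp add: inverse_eq_divide)
  qed
  have "(\<lambda>m. measure lborel {0..y m}) \<longlonglongrightarrow> measure lborel {0..x}"
    using x y01 lim by (simp add: measure_anchored_box tendsto_prod)
  moreover have "(\<lambda>m. indicator {0..y m} w :: real) \<longlonglongrightarrow> indicator {0..x} w" for w
  proof -
    have "\<forall>\<^sub>F m in sequentially. (w \<in> {0..y m}) = (w \<in> {0..x})"
    proof (cases "w \<le> x")
      case True
      then have "w \<le> y m" for m using xy by (auto simp: less_eq_vec_def intro: order_trans)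
      then show ?thesis using True by auto
    next
      case False
      then obtain i where "x $ i < w $ i" by (auto simp: less_eq_vec_def not_le)
      then have "\<forall>\<^sub>F m in sequentially. y m $ i < w $ i" using lim by (rule order_tendstoD(2)[rotated])
      then show ?thesis
      proof eventually_elim
        case (elim m)
        then have "\<not> w \<le> y m" by (auto simp: less_eq_vec_def not_le)
        then show ?case using False by simp
      qed
    qed
    then show ?thesis
      by (intro tendsto_eventually) (auto elim!: eventually_mono simp: indicator_def)
  qed
  ultimately have "(\<lambda>m. local_discrepancy N z {0..y m}) \<longlonglongrightarrow> local_discrepancy N z {0..x}"
    unfolding local_discrepancy_def by (intro tendsto_intros) auto
  moreover have "y m $ i \<in> \<rat>" for m i using r(1) by (auto simp: y_def min_def)
  ultimately show ?thesis using that y01 by blast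
qed

lemma countable_rational_vectors: "countable {y :: real ^ 's. \<forall>i. y $ i \<in> \<rat>}"
proof -
  have "{y :: real ^ 's. \<forall>i. y $ i \<in> \<rat>} = vec_lambda ` PiE UNIV (\<lambda>_. \<rat>)"
  proof (intro equalityI subsetI)
    fix y :: "real ^ 's" assume "y \<in> {y. \<forall>i. y $ i \<in> \<rat>}"
    then show "y \<in> vec_lambda ` PiE UNIV (\<lambda>_. \<rat>)"
      by (intro image_eqI[of _ _ "vec_nth y"]) auto
  qed auto
  then show ?thesis by (auto intro!: countable_image countable_PiE countable_rat)
qed

lemma (in uniform_sample) star_discrepancy_event_measurable:
  "{\<omega> \<in> space M. star_discrepancy N (\<lambda>n. z n \<omega>) \<le> c} \<in> sets M"
proof -
  define Q where "Q = {y :: real ^ 's. y \<in> {0..1} \<and> (\<forall>i. y $ i \<in> \<rat>)}"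
  have Q: "countable Q" by (rule countable_subset[OF _ countable_rational_vectors]) (auto simp: Q_def)
  have "star_discrepancy N (\<lambda>n. z n \<omega>) \<le> c \<longleftrightarrow> (\<forall>y\<in>Q. \<bar>dev {0..y} \<omega>\<bar> \<le> real N * c)" for \<omega>
    unfolding star_discrepancy_le_iff[OF N]
  proof (intro iffI ballI)
    fix x :: "real ^ 's" assume *: "\<forall>y\<in>Q. \<bar>dev {0..y} \<omega>\<bar> \<le> real N * c" and x: "x \<in> {0..1}"
    obtain y where "\<And>m. y m \<in> {0..1}" "\<And>m i. y m $ i \<in> \<rat>"
      and lim: "(\<lambda>m. dev {0..y m} \<omega>) \<longlonglongrightarrow> dev {0..x} \<omega>"
      using local_discrepancy_rational_approx[OF x] by metis
    then have "y m \<in> Q" for m by (simp add: Q_def)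
    then show "\<bar>dev {0..x} \<omega>\<bar> \<le> real N * c"
      using * by (intro LIMSEQ_le_const2[OF tendsto_rabs[OF lim]]) auto
  qed (auto simp: Q_def)
  then have "{\<omega> \<in> space M. star_discrepancy N (\<lambda>n. z n \<omega>) \<le> c} =
      {\<omega> \<in> space M. \<forall>y\<in>Q. \<bar>dev {0..y} \<omega>\<bar> \<le> real N * c}" by simp
  also have "\<dots> \<in> sets M"
    by (rule sets.sets_Collect_countable_All'[OF _ Q]) measurable
  finally show ?thesis .
qed

section \<open>Chaining\<close>

lemma local_discrepancy_empty [simp]: "local_discrepancy N z {} = 0"
  by (simp add: local_discrepancy_def)

lemma local_discrepancy_split:
  assumes "A \<in> fmeasurable lborel" "B \<in> fmeasurable lborel" "B \<subseteq> A"
  shows "local_discrepancy N z A = local_discrepancy N z B + local_discrepancy N z (A - B)"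
proof -
  have "indicator A y = (indicator B y + indicator (A - B) y :: real)" for y
    using assms(3) by (auto simp: indicator_def)
  moreover have "measure lborel (A - B) = measure lborel A - measure lborel B"
    using assms by (intro measure_Diff) (auto simp: fmeasurable_def)
  ultimately show ?thesis
    by (simp add: local_discrepancy_def sum.distrib right_diff_distrib)
qed

text \<open>The predecessor of a grid box in a chain: some lower bracket of \<open>A\<close> at level \<open>k\<close>, possibly
  empty. That it is a function of \<open>A\<close> matters for the union bound, since a level contributes only as
  many differences \<open>A - parent k A\<close> as it has boxes.\<close>

definition parent :: "nat \<Rightarrow> (real ^ 's) set \<Rightarrow> (real ^ 's) set" where
  "parent k A = (SOME B. B \<in> insert {} (grid_boxes k) \<and> B \<subseteq> A \<and> measure lborel (A - B) \<le> 1 / 2 ^ k)"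

lemma parent:
  fixes A :: "(real ^ 's) set"
  assumes A: "A \<in> grid_boxes l"
  shows "parent k A \<in> insert {} (grid_boxes k)" "parent k A \<subseteq> A"
    "measure lborel (A - parent k A) \<le> 1 / 2 ^ k"
proof -
  have "\<exists>B. B \<in> insert {} (grid_boxes k) \<and> B \<subseteq> A \<and> measure lborel (A - B) \<le> 1 / 2 ^ k"
  proof -
    obtain x :: "real ^ 's" where x: "A = {0..x}" "x \<in> {0..1}"
      using A grid_boxes_unit_cube[OF A] grid_point_nonneg by (fastforce simp: grid_boxes_def)
    obtain v w where vw: "v \<in> insert {} (grid_boxes k)" "w \<in> grid_boxes k"
        "v \<subseteq> A" "A \<subseteq> w" "measure lborel w - measure lborel v \<le> 1 / 2 ^ k"
      using grid_boxes_bracket[OF x(2), of k] unfolding x(1) by metis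
    have fm: "A \<in> fmeasurable lborel" "v \<in> fmeasurable lborel" "w \<in> fmeasurable lborel"
      using A vw grid_boxes_fmeasurable by auto
    have "measure lborel (A - v) = measure lborel A - measure lborel v"
      using vw fm by (intro measure_Diff) (auto simp: fmeasurable_def)
    also have "\<dots> \<le> measure lborel w - measure lborel v"
      using vw fm by (intro diff_mono measure_mono_fmeasurable) auto
    finally show ?thesis using vw by (intro exI[of _ v]) auto
  qed
  from someI_ex[OF this]
  show "parent k A \<in> insert {} (grid_boxes k)" "parent k A \<subseteq> A"
    "measure lborel (A - parent k A) \<le> 1 / 2 ^ k" unfolding parent_def by blast+
qed

lemma parent_fmeasurable: "A \<in> grid_boxes l \<Longrightarrow> parent k A \<in> fmeasurable lborel"
  using parent(1)[of A l k] grid_boxes_fmeasurable by auto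

lemma local_discrepancy_chain:
  assumes coarse: "\<And>A. A \<in> grid_boxes k \<Longrightarrow> \<bar>local_discrepancy N z A\<bar> \<le> a"
    and link: "\<And>j A. j < n \<Longrightarrow> A \<in> grid_boxes (Suc (k + j)) \<Longrightarrow>
      \<bar>local_discrepancy N z (A - parent (k + j) A)\<bar> \<le> b j"
    and nonneg: "a \<ge> 0" "\<And>j. b j \<ge> 0"
    and A: "A \<in> grid_boxes (k + n)"
  shows "\<bar>local_discrepancy N z A\<bar> \<le> a + (\<Sum>j<n. b j)"
  using link A
proof (induction n arbitrary: A)
  case 0
  then show ?case using coarse by simp
next
  case (Suc n)
  define B where "B = parent (k + n) A"
  have A: "A \<in> grid_boxes (Suc (k + n))" using Suc.prems by simp
  have "\<bar>local_discrepancy N z B\<bar> \<le> a + (\<Sum>j<n. b j)"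
  proof (cases "B = {}")
    case True
    then show ?thesis using nonneg by (simp add: sum_nonneg)
  next
    case False
    then have "B \<in> grid_boxes (k + n)" using parent(1)[OF A, of "k + n"] by (simp add: B_def)
    then show ?thesis using Suc.prems(1) by (intro Suc.IH) auto
  qed
  moreover have "\<bar>local_discrepancy N z (A - B)\<bar> \<le> b n"
    unfolding B_def using A by (intro Suc.prems(1)) auto
  moreover have "local_discrepancy N z A = local_discrepancy N z B + local_discrepancy N z (A - B)"
    unfolding B_def using A
    by (intro local_discrepancy_split grid_boxes_fmeasurable parent_fmeasurable parent)
  ultimately show ?case by simp
qed

lemma local_discrepancy_bracket:
  assumes x: "x \<in> {0..1}"
    and grid: "\<And>A. A \<in> grid_boxes k \<Longrightarrow> \<bar>local_discrepancy N z A\<bar> \<le> a" and "a \<ge> 0"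
  shows "\<bar>local_discrepancy N z {0..x}\<bar> \<le> a + real N / 2 ^ k"
proof -
  obtain v w where vw: "v \<in> insert {} (grid_boxes k)" "w \<in> grid_boxes k"
      "v \<subseteq> {0..x}" "{0..x} \<subseteq> w" "measure lborel w - measure lborel v \<le> 1 / 2 ^ k"
    using grid_boxes_bracket[OF x] by metis
  have fm: "v \<in> fmeasurable lborel" "w \<in> fmeasurable lborel" "{0..x} \<in> fmeasurable lborel"
    using vw grid_boxes_fmeasurable fmeasurable_anchored_box by auto
  have ld: "\<bar>local_discrepancy N z v\<bar> \<le> a" "\<bar>local_discrepancy N z w\<bar> \<le> a"
    using vw grid \<open>a \<ge> 0\<close> by auto
  have vol: "measure lborel v \<le> measure lborel {0..x}" "measure lborel {0..x} \<le> measure lborel w"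
    using vw fm by (auto intro!: measure_mono_fmeasurable)
  define Z where "Z A = (\<Sum>n = 1..N. indicator A (z n) :: real)" for A
  have count: "Z v \<le> Z {0..x}" "Z {0..x} \<le> Z w"
    using vw(3,4) unfolding Z_def by (intro sum_mono; auto split: split_indicator)+
  have scaled: "real N * measure lborel v \<le> real N * measure lborel {0..x}"
      "real N * measure lborel {0..x} \<le> real N * measure lborel w"
    using vol by (auto intro!: mult_left_mono)
  have "real N * (measure lborel w - measure lborel v) \<le> real N * (1 / 2 ^ k)"
    using vw(5) by (intro mult_left_mono) auto
  then have "real N * measure lborel w - real N * measure lborel v \<le> real N / 2 ^ k"
    by (simp add: right_diff_distrib)
  with ld scaled count show ?thesis
    unfolding local_discrepancy_def Z_def[symmetric] by linarith
qed

section \<open>Failure probabilities and the tail bound\<close>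

text \<open>The union bound, with all quantities written as exponentials.\<close>

lemma (in prob_space) prob_UN_le_exp:
  assumes "finite I" "\<And>A. A \<in> I \<Longrightarrow> E A \<in> events" "\<And>A. A \<in> I \<Longrightarrow> prob (E A) \<le> 2 * exp (- c)"
    and "real (card I) \<le> exp b" "2 ^ i \<le> exp d" "b + d - c \<le> - t"
  shows "prob (\<Union>A\<in>I. E A) \<le> 2 * exp (- t) / 2 ^ i"
proof -
  have "prob (\<Union>A\<in>I. E A) \<le> (\<Sum>A\<in>I. prob (E A))"
    using assms(1,2) by (intro finite_measure_subadditive_finite) auto
  also have "\<dots> \<le> real (card I) * (2 * exp (- c))"
    using assms(3) by (rule sum_bounded_above)
  finally have "prob (\<Union>A\<in>I. E A) * 2 ^ i \<le> real (card I) * (2 * exp (- c)) * 2 ^ i"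
    by (rule mult_right_mono) auto
  also have "\<dots> \<le> exp b * (2 * exp (- c)) * exp d"
    using assms(4,5) by (intro mult_mono) auto
  also have "\<dots> = 2 * exp (b + d - c)" by (simp add: exp_add[symmetric] exp_diff exp_minus field_simps)
  also have "\<dots> \<le> 2 * exp (- t)" using assms(6) by simp
  finally show ?thesis by (simp add: field_simps)
qed

lemma two_power_le_exp: "(2::real) ^ i \<le> exp (3/4 * real i)"
proof -
  have "(2::real) \<le> exp (3/4)" using exp_lower_Taylor_quadratic[of "3/4"] by (simp add: power2_eq_square)
  then have "(2::real) ^ i \<le> exp (3/4) ^ i" by (intro power_mono) auto
  then show ?thesis by (simp add: exp_of_nat_mult[symmetric] mult.commute)
qed

context uniform_sample
begin

text \<open>By Hoeffding's inequality a box fails with probability at most \<open>2 exp (- 2 s (4.9 + t))\<close>, while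
  there are at most \<open>exp (6 s)\<close> boxes.\<close>

lemma coarse_level_failure:
  fixes t :: real
  assumes t: "t \<ge> 0" and T: "T \<ge> 0" "T\<^sup>2 = (4.9 + t) * real CARD('s) * real N"
  shows "prob (\<Union>A\<in>grid_boxes 4. {\<omega> \<in> space M. \<bar>dev A \<omega>\<bar> \<ge> T}) \<le> exp (- t) / 2"
proof -
  define s where "s = real CARD('s)"
  have s: "s \<ge> 1" by (simp add: s_def Suc_le_eq)
  have st: "t \<le> s * t" using mult_right_mono[OF s t] by simp
  have "prob (\<Union>A\<in>grid_boxes 4. {\<omega> \<in> space M. \<bar>dev A \<omega>\<bar> \<ge> T}) \<le> 2 * exp (- t) / 2 ^ 2"
  proof (rule prob_UN_le_exp)
    fix A :: "(real ^ 's) set" assume A: "A \<in> grid_boxes 4"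
    then have A': "A \<in> sets borel" "A \<subseteq> {0..1}"
      using grid_boxes_fmeasurable[OF A] grid_boxes_unit_cube[OF A] by (auto simp: fmeasurable_def)
    note [measurable] = A'(1)
    show "{\<omega> \<in> space M. T \<le> \<bar>dev A \<omega>\<bar>} \<in> events" by measurable
    have "- 2 * T\<^sup>2 / real N = - (2 * s * (4.9 + t))"
      using N by (simp add: T(2) s_def field_simps)
    then show "prob {\<omega> \<in> space M. T \<le> \<bar>dev A \<omega>\<bar>} \<le> 2 * exp (- (2 * s * (4.9 + t)))"
      using hoeffding_dev[OF A' T(1)] by simp
  next
    show "real (card (grid_boxes 4 :: (real ^ 's) set set)) \<le> exp (s * 6)"
      using card_grid_boxes[where 's = 's, of 4] by (simp add: s_def)
    show "(2::real)\<^sup>2 \<le> exp (3/4 * real 2)" by (rule two_power_le_exp)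
    show "s * 6 + 3 / 4 * real 2 - 2 * s * (4.9 + t) \<le> - t"
      using s t st by (simp add: algebra_simps)
  qed (rule finite_grid_boxes)
  then show ?thesis by simp
qed

text \<open>The differences between the levels \<open>5 + j\<close> and \<open>4 + j\<close> have volume at most \<open>P = 1 / 2 ^ (4 + j)\<close>.
  Since \<open>(3/4)\<^sup>2 > 1/2\<close>, the exponent \<open>3.24 (9/8) ^ j s (4.9 + t)\<close> of the Bernstein bound grows with
  \<open>j\<close>, and by Bernoulli's inequality it outweighs the \<open>exp (s (j + 7))\<close> boxes. The hypothesis on \<open>T\<close>
  keeps the deviation within the Gaussian range.\<close>

lemma link_level_failure:
  fixes t :: real
  assumes t: "t \<ge> 0" and T: "T > 0" "T\<^sup>2 = (4.9 + t) * real CARD('s) * real N"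
    and j: "T \<le> real N / 2 ^ (4 + j)"
  shows "prob (\<Union>A\<in>grid_boxes (Suc (4 + j)).
      {\<omega> \<in> space M. \<bar>dev (A - parent (4 + j) A) \<omega>\<bar> \<ge> 9/10 * (3/4) ^ j * T}) \<le> exp (- t) / 2 ^ (j + 2)"
proof -
  define s where "s = real CARD('s)"
  have s: "s \<ge> 1" by (simp add: s_def Suc_le_eq)
  define \<epsilon> where "\<epsilon> = 9/10 * (3/4) ^ j * T"
  define P :: real where "P = 1 / 2 ^ (4 + j)"
  define c where "c = 3.24 * (9/8) ^ j * s * (4.9 + t)"
  have "(3/4::real) ^ j \<le> 1" by (intro power_le_one) auto
  then have "\<epsilon> \<le> 1 * T" unfolding \<epsilon>_def using T by (intro mult_right_mono) auto
  also have "\<dots> \<le> real N * P" using j by (simp add: P_def)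
  also have "\<dots> \<le> 2 * real N * P" by (simp add: P_def divide_right_mono)
  finally have \<epsilon>: "0 < \<epsilon>" "\<epsilon> \<le> 2 * real N * P" using T by (auto simp: \<epsilon>_def)
  have exponent: "\<epsilon>\<^sup>2 / (4 * real N * P) = c"
  proof -
    have e1: "\<epsilon>\<^sup>2 = 81/100 * (9/16) ^ j * T\<^sup>2"
      by (simp add: \<epsilon>_def power_mult_distrib power2_eq_square power_mult_distrib[symmetric])
    have e2: "\<epsilon>\<^sup>2 / (4 * real N * P) = \<epsilon>\<^sup>2 * (4 * 2 ^ j) / real N"
      by (simp add: P_def power_add)
    have "\<epsilon>\<^sup>2 / (4 * real N * P) = 81/25 * ((9/16) ^ j * 2 ^ j) * (T\<^sup>2 / real N)"
      unfolding e2 unfolding e1 by simp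
    also have "(9/16) ^ j * 2 ^ j = (9/8 :: real) ^ j"
      by (simp add: power_mult_distrib[symmetric])
    also have "T\<^sup>2 / real N = (4.9 + t) * s" using N by (simp add: T(2) s_def)
    finally show ?thesis by (simp add: c_def)
  qed
  have "1 + real j * (1/8) \<le> (1 + 1/8) ^ j" by (rule Bernoulli_inequality) auto
  then have "3.24 * (1 + real j / 8) * (s * (4.9 + t)) \<le> 3.24 * (9/8) ^ j * (s * (4.9 + t))"
    using s t by (intro mult_right_mono) auto
  also have "\<dots> = c" by (simp add: c_def)
  finally have c: "3.24 * (1 + real j / 8) * (s * (4.9 + t)) \<le> c" .
  have large: "s * (real j + 7) + 3/4 * real (j + 3) - c \<le> - t"
  proof -
    define u where "u = 3/4 * real (j + 3)"
    define g where "g = 3.24 * (1 + real j / 8)"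
    have "u \<le> s * u" using mult_right_mono[OF s, of u] by (simp add: u_def)
    moreover have "t \<le> s * t" using mult_right_mono[OF s t] by simp
    moreover have "s * t * 1 \<le> s * t * g"
      unfolding g_def using s t by (intro mult_left_mono mult_nonneg_nonneg) auto
    moreover have "s * (real j + 7) + s * u \<le> s * (g * 4.9)"
      unfolding distrib_left[symmetric]
    proof (rule mult_left_mono)
      show "real j + 7 + u \<le> g * 4.9" by (simp add: u_def g_def field_simps)
    qed (use s in simp)
    moreover have "s * (g * 4.9) + s * t * g \<le> c"
      using c unfolding g_def[symmetric] by (simp add: algebra_simps)
    ultimately have "s * (real j + 7) + u - c \<le> - t" by linarith
    then show ?thesis by (simp add: u_def)
  qed
  have "prob (\<Union>A\<in>grid_boxes (Suc (4 + j)). {\<omega> \<in> space M. \<bar>dev (A - parent (4 + j) A) \<omega>\<bar> \<ge> \<epsilon>})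
      \<le> 2 * exp (- t) / 2 ^ (j + 3)"
  proof (rule prob_UN_le_exp)
    fix A :: "(real ^ 's) set" assume A: "A \<in> grid_boxes (Suc (4 + j))"
    then have A': "A - parent (4 + j) A \<in> sets borel" "A - parent (4 + j) A \<subseteq> {0..1}"
      using grid_boxes_fmeasurable[OF A] parent_fmeasurable[OF A] grid_boxes_unit_cube[OF A]
      by (auto simp: fmeasurable_def)
    note [measurable] = A'(1)
    show "{\<omega> \<in> space M. \<epsilon> \<le> \<bar>dev (A - parent (4 + j) A) \<omega>\<bar>} \<in> events" by measurable
    show "prob {\<omega> \<in> space M. \<epsilon> \<le> \<bar>dev (A - parent (4 + j) A) \<omega>\<bar>} \<le> 2 * exp (- c)"
      unfolding exponent[symmetric] using \<epsilon> parent(3)[OF A, of "4 + j"]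
      by (intro bernstein_dev A') (auto simp: P_def)
  next
    show "real (card (grid_boxes (Suc (4 + j)) :: (real ^ 's) set set)) \<le> exp (s * (real j + 7))"
      using card_grid_boxes[where 's = 's, of "Suc (4 + j)"] by (simp add: s_def add_ac)
    show "(2::real) ^ (j + 3) \<le> exp (3/4 * real (j + 3))" by (rule two_power_le_exp)
  qed (fact finite_grid_boxes large)+
  also have "2 * exp (- t) / 2 ^ (j + 3) = exp (- t) / 2 ^ (j + 2)" by (simp add: power_add)
  finally show ?thesis by (simp add: \<epsilon>_def)
qed

theorem star_discrepancy_tail:
  fixes t :: real
  assumes t: "t \<ge> 0"
  shows "prob {\<omega> \<in> space M. star_discrepancy N (\<lambda>n. z n \<omega>)
      \<le> 5.7 * sqrt (4.9 + t) * (sqrt (real CARD('s)) / sqrt (real N))} \<ge> 1 - exp (- t)"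
    (is "prob ?good \<ge> _")
proof -
  define T where "T = sqrt (4.9 + t) * sqrt (real CARD('s)) * sqrt (real N)"
  have T: "T > 0" "T\<^sup>2 = (4.9 + t) * real CARD('s) * real N"
    using t N by (auto simp: T_def power_mult_distrib intro!: mult_pos_pos)
  have "\<exists>J. real N / 2 ^ (4 + J) \<le> T"
  proof -
    obtain J where "real N / T < 2 ^ J" using real_arch_pow[of 2 "real N / T"] by auto
    then have "real N / 2 ^ J \<le> T" using T by (simp add: field_simps)
    moreover have "real N / 2 ^ (4 + J) \<le> real N / 2 ^ J"
      by (intro divide_left_mono power_increasing) auto
    ultimately show ?thesis using order_trans by blast
  qed
  \<comment> \<open>Minimality of \<open>J\<close> provides the hypothesis on \<open>T\<close> for every link below level \<open>4 + J\<close>.\<close>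
  then obtain J where J: "real N / 2 ^ (4 + J) \<le> T"
    and least: "\<And>j. j < J \<Longrightarrow> T \<le> real N / 2 ^ (4 + j)"
    using exists_least_iff[of "\<lambda>J. real N / 2 ^ (4 + J) \<le> T"] by (metis linear)
  define b where "b j = 9/10 * (3/4) ^ j * T" for j
  \<comment> \<open>The failure events: index \<open>0\<close> is the coarse level, index \<open>j + 1\<close> the link from level \<open>5 + j\<close> to
    level \<open>4 + j\<close>.\<close>
  define E where "E i = (if i = 0 then \<Union>A\<in>grid_boxes 4. {\<omega> \<in> space M. \<bar>dev A \<omega>\<bar> \<ge> T}
    else \<Union>A\<in>grid_boxes (Suc (4 + (i - 1))).
      {\<omega> \<in> space M. \<bar>dev (A - parent (4 + (i - 1)) A) \<omega>\<bar> \<ge> b (i - 1)})" for i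
  have E_events: "E i \<in> events" for i
  proof -
    have [measurable]: "A \<in> sets borel" "A - parent l A \<in> sets borel"
      if "A \<in> grid_boxes k" for k l and A :: "(real ^ 's) set"
      using grid_boxes_fmeasurable[OF that] parent_fmeasurable[OF that] by (auto simp: fmeasurable_def)
    show ?thesis unfolding E_def
      by (auto intro!: sets.finite_UN finite_grid_boxes) measurable
  qed
  have E_prob: "prob (E i) \<le> exp (- t) * (1/2) ^ Suc i" if "i \<le> J" for i
  proof (cases i)
    case 0
    then show ?thesis using coarse_level_failure[OF t _ T(2)] T by (simp add: E_def)
  next
    case (Suc j)
    then show ?thesis using link_level_failure[OF t T least[of j]] that
      by (simp add: E_def b_def power_one_over field_simps)
  qed
  have "prob (\<Union>i\<le>J. E i) \<le> (\<Sum>i\<le>J. prob (E i))"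
    using E_events by (intro finite_measure_subadditive_finite) auto
  also have "\<dots> \<le> (\<Sum>i\<le>J. exp (- t) * (1/2) ^ Suc i)" using E_prob by (intro sum_mono) auto
  also have "\<dots> = exp (- t) * ((\<Sum>i\<le>J. (1/2) ^ i) / 2)" 
    by (simp add: sum_distrib_left sum_divide_distrib)
  also have "\<dots> \<le> exp (- t) * 1"
    by (intro mult_left_mono) (auto simp: sum_gp0)
  finally have bad: "prob (\<Union>i\<le>J. E i) \<le> exp (- t)" by simp
  have sum_b: "(\<Sum>j<J. b j) \<le> 3.6 * T"
  proof -
    have "(\<Sum>j<J. b j) = (\<Sum>j<J. (3/4) ^ j) * (9/10 * T)"
      unfolding b_def sum_distrib_right by (intro sum.cong) auto
    also have "\<dots> \<le> 4 * (9/10 * T)"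
      using T by (intro mult_right_mono) (auto simp: sum_gp_strict)
    finally show ?thesis by simp
  qed
  have "space M - (\<Union>i\<le>J. E i) \<subseteq> ?good"
  proof
    fix \<omega> assume \<omega>: "\<omega> \<in> space M - (\<Union>i\<le>J. E i)"
    have coarse: "\<bar>dev A \<omega>\<bar> \<le> T" if "A \<in> grid_boxes 4" for A
    proof -
      have "\<omega> \<notin> E 0" using \<omega> by auto
      then show ?thesis using \<omega> that by (auto simp: E_def)
    qed
    have link: "\<bar>dev (A - parent (4 + j) A) \<omega>\<bar> \<le> b j" if "j < J" "A \<in> grid_boxes (Suc (4 + j))" for j A
    proof -
      have "\<omega> \<notin> E (Suc j)" using \<omega> that(1) by auto
      then show ?thesis using \<omega> that(2) by (auto simp: E_def)
    qed
    have grid: "\<bar>dev A \<omega>\<bar> \<le> T + (\<Sum>j<J. b j)" if "A \<in> grid_boxes (4 + J)" for A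
      by (rule local_discrepancy_chain[OF coarse link _ _ that]) (use T in \<open>auto simp: b_def\<close>)
    have "\<bar>dev {0..x} \<omega>\<bar> \<le> real N * (5.7 * sqrt (4.9 + t) * (sqrt (real CARD('s)) / sqrt (real N)))"
      if "x \<in> {0..1}" for x
    proof -
      have "\<bar>dev {0..x} \<omega>\<bar> \<le> T + (\<Sum>j<J. b j) + real N / 2 ^ (4 + J)"
        using T by (intro local_discrepancy_bracket[OF that grid])
          (auto simp: b_def intro!: add_nonneg_nonneg sum_nonneg)
      also have "\<dots> \<le> 5.7 * T" using sum_b J T by linarith
      also have "T = real N * (sqrt (4.9 + t) * (sqrt (real CARD('s)) / sqrt (real N)))"
        unfolding T_def using N by (simp add: field_simps)
      finally show ?thesis by (simp add: mult_ac)
    qed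
    then show "\<omega> \<in> ?good" using \<omega> by (simp add: star_discrepancy_le_iff[OF N])
  qed
  then have "prob (space M - (\<Union>i\<le>J. E i)) \<le> prob ?good"
    by (intro finite_measure_mono star_discrepancy_event_measurable)
  moreover have "prob (space M - (\<Union>i\<le>J. E i)) = 1 - prob (\<Union>i\<le>J. E i)"
    using E_events by (intro prob_compl) auto
  ultimately show ?thesis using bad by linarith
qed

end

theorem corollary1:
  fixes M :: "'a measure" and z :: "nat \<Rightarrow> 'a \<Rightarrow> real ^ 's" and N :: nat and q :: real
  assumes "prob_space M"
    and "N \<ge> 1"
    and "0 < q" and "q < 1"
    and "prob_space.indep_vars M (\<lambda>_. borel) z {1..N}"
    and "\<And>n. n \<in> {1..N} \<Longrightarrow> distr M borel (z n) = uniform_measure lborel {0..1}"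
  shows "measure M {\<omega> \<in> space M. star_discrepancy N (\<lambda>n. z n \<omega>)
           \<le> 5.7 * sqrt (4.9 + ln (inverse (1 - q))) * (sqrt (real CARD('s)) / sqrt (real N))} \<ge> q"
proof -
  interpret uniform_sample M z N
    using assms by (simp add: uniform_sample_def uniform_sample_axioms_def)
  have "ln (inverse (1 - q)) = - ln (1 - q)" using assms(4) by (simp add: ln_inverse)
  moreover have "ln (1 - q) \<le> 0" using assms(3,4) by simp
  ultimately show ?thesis
    using star_discrepancy_tail[of "ln (inverse (1 - q))"] assms(4) by simp
qed

end
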